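(* Let $\langle N, \underline{\mathcal{A}}, \Theta, \underline{U}\rangle$ be a finite game with uncertainty, let $(\underline{\sigma}^*;\underline{\pi}^* )$ be an extended equilibrium, let $i\in\{1,\dots,N\}$ and $\eta\in\Theta$, and suppose that player $i$'s equilibrium prior is the pure prior concentrated at $\eta$, i.e. $\pi_i^*(\theta)=\delta_{\eta,\theta}$ for all $\theta\in\Theta$ (Kronecker delta). Then: 1. The parameter is irrelevant for player $i$ in this equilibrium: there is an action (or actions) $a_i\in\mathcal{A}_i$ that is a best response regardless of the unknown parameter, i.e. $$\mathrm{EU}_i(a_i;\theta|\underline{\sigma}^* )\ge \mathrm{EU}_i(c_i;\theta|\underline{\sigma}^* )\quad\text{for all }c_i\in\mathcal{A}_i\text{ and all }\theta\in\Theta.$$ 2. The prior $\pi_i^*$ is totally degenerate, in the following sense: for every $\pi_i'\in\Delta(\Theta)$, the complete strategy profile obtained from $(\underline{\sigma}^*;\underline{\pi}^* )$ by replacing $\pi_i^*$ with $\pi_i'$ (and leaving all other components unchanged) is also an extended equilibrium. 3. Therefore, a continuum set of extended equilibria exists in this case.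
   Context: **Game with uncertainty.** A (finite, $N$-person, non-cooperative) game with (global) uncertainty is a tuple $\langle N, \underline{\mathcal{A}}, \Theta, \underline{U}\rangle$ where $N\ge 1$ is an integer (the number of players); $\underline{\mathcal{A}} = (\mathcal{A}_1,\dots,\mathcal{A}_N)$ with every $\mathcal{A}_i$ a finite nonempty set (actions of player $i$); $\Theta$ is a finite nonempty set (values of the unknown parameter); and $\underline{U}=(U_1,\dots,U_N)$ with $U_i:\mathcal{A}_1\times\dots\times\mathcal{A}_N\times\Theta\to\mathbb{R}$ an arbitrary function (utility of player $i$). We write $\underline{a}\in\underline{\mathcal{A}}$ for $\underline{a}=(a_1,\dots,a_N)\in\mathcal{A}_1\times\dots\times\mathcal{A}_N$, and $\underline{b}^{[i]\leftarrow a_i}$ for the tuple obtained from $\underline{b}$ by replacing its $i$-th entry by $a_i$. **Profiles.** For a finite set $S$, $\Delta(S)=\{p:S\to[0,1] \mid \sum_{s\in S}p(s)=1\}$. A complete strategy profile is $\underline{\rho}=(\underline{\sigma};\underline{\pi})$ with $\underline{\sigma}=(\sigma_1,\dots,\sigma_N)$, $\sigma_i\in\Delta(\mathcal{A}_i)$ (mixed strategies), and $\underline{\pi}=(\pi_1,\dots,\pi_N)$, $\pi_i\in\Delta(\Theta)$ (subjective priors). The set of complete strategy profiles is $\mathcal{R}=\left(\prod_{i=1}^N\Delta(\mathcal{A}_i)\right)\times\Delta(\Theta)^N$. **Probabilities.** $\Pi(\underline{a}|\underline{\sigma})=\prod_{j=1}^N\sigma_j(a_j)$ and $\Pi_i(\underline{a};\theta|\underline{\sigma};\underline{\pi})=\left(\prod_{j=1}^N\sigma_j(a_j)\right)\pi_i(\theta)$.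 **Personal regret.** $$R_i(\underline{a};\theta|\underline{\sigma})=\max_{c_i\in\mathcal{A}_i}\Big(\sum_{\underline{b}\in\underline{\mathcal{A}}}U_i(\underline{b}^{[i]\leftarrow c_i};\theta)\,\Pi(\underline{b}|\underline{\sigma})\Big)-U_i(\underline{a};\theta).$$ **Expected utilities and regrets.** $$\mathrm{EU}_i(\underline{\sigma};\underline{\pi})=\sum_{\underline{a}\in\underline{\mathcal{A}},\,\theta\in\Theta}U_i(\underline{a};\theta)\,\Pi_i(\underline{a};\theta|\underline{\sigma};\underline{\pi}),\qquad \mathrm{EU}_i(a_i|\underline{\sigma};\underline{\pi})=\sum_{\underline{b}\in\underline{\mathcal{A}},\,\theta\in\Theta}U_i(\underline{b}^{[i]\leftarrow a_i};\theta)\,\Pi_i(\underline{b};\theta|\underline{\sigma};\underline{\pi}),$$ $$\mathrm{ER}_i(\underline{\sigma};\underline{\pi})=\sum_{\underline{a}\in\underline{\mathcal{A}},\,\theta\in\Theta}R_i(\underline{a};\theta|\underline{\sigma})\,\Pi_i(\underline{a};\theta|\underline{\sigma};\underline{\pi}),\qquad \mathrm{ER}_i(\theta|\underline{\sigma};\underline{\pi})=\sum_{\underline{a}\in\underline{\mathcal{A}}}R_i(\underline{a};\theta|\underline{\sigma})\,\Pi(\underline{a}|\underline{\sigma}).$$ The expected (effective) utility matrix of player $i$ is $$\mathrm{EU}_i(a_i;\theta|\underline{\sigma})=\sum_{\underline{b}\in\underline{\mathcal{A}}}U_i(\underline{b}^{[i]\leftarrow a_i};\theta)\,\Pi(\underline{b}|\underline{\sigma}).$$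 **Extended equilibrium.** $(\underline{\sigma}^*;\underline{\pi}^* )\in\mathcal{R}$ is an extended equilibrium if for every $i\in\{1,\dots,N\}$: $\mathrm{EU}_i(\underline{\sigma}^*;\underline{\pi}^* )\ge\mathrm{EU}_i(a_i|\underline{\sigma}^*;\underline{\pi}^* )$ for all $a_i\in\mathcal{A}_i$, and $\mathrm{ER}_i(\underline{\sigma}^*;\underline{\pi}^* )\ge\mathrm{ER}_i(\theta|\underline{\sigma}^*;\underline{\pi}^* )$ for all $\theta\in\Theta$.
   Formalization: Part 3 is stated only when Θ has at least two elements; for a one-element Θ it fails, e.g. one player with a single action and a single parameter value has exactly one complete strategy profile, hence only one extended equilibrium. *)

theory Defs
  imports Complex_Main "HOL-Library.FuncSet" "HOL-Library.Equipollence"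
begin

(* The players are 1, ..., num_players.  The action sets of different players may differ, but they
   live in one common type; this is no restriction, since finitely many finite sets always embed
   into a common type (for instance nat).  The values of utility i a t are relevant only for a
   player i, an action profile a and a parameter value t in params. *)
record ('a, 't) game =
  num_players :: nat
  actions :: "nat \<Rightarrow> 'a set"
  params :: "'t set"
  utility :: "nat \<Rightarrow> (nat \<Rightarrow> 'a) \<Rightarrow> 't \<Rightarrow> real"

definition players :: "('a, 't) game \<Rightarrow> nat set" where
  "players G = {1..num_players G}"

definition game_with_uncertainty :: "('a, 't) game \<Rightarrow> bool" where
  "game_with_uncertainty G \<longleftrightarrow>
     1 \<le> num_players G \<and>
     (\<forall>i\<in>players G. finite (actions G i) \<and> actions G i \<noteq> {}) \<and>
     finite (params G) \<and> params G \<noteq> {}"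

(* Tuples and distributions are extensional functions (PiE), so that distinct functions represent
   distinct mathematical objects; this matters when equilibria are counted.  The tuple b with its
   i-th entry replaced by c is the function update b(i := c). *)

definition action_profiles :: "('a, 't) game \<Rightarrow> (nat \<Rightarrow> 'a) set" where
  "action_profiles G = PiE (players G) (actions G)"

definition simplex :: "'s set \<Rightarrow> ('s \<Rightarrow> real) set" where
  "simplex S = {p \<in> S \<rightarrow>\<^sub>E {0..1}. (\<Sum>s\<in>S. p s) = 1}"

definition complete_profiles ::
    "('a, 't) game \<Rightarrow> ((nat \<Rightarrow> 'a \<Rightarrow> real) \<times> (nat \<Rightarrow> 't \<Rightarrow> real)) set" where
  "complete_profiles G =
     (PiE (players G) (\<lambda>i. simplex (actions G i))) \<times> (players G \<rightarrow>\<^sub>E simplex (params G))"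

definition profile_prob :: "('a, 't) game \<Rightarrow> (nat \<Rightarrow> 'a \<Rightarrow> real) \<Rightarrow> (nat \<Rightarrow> 'a) \<Rightarrow> real" where
  "profile_prob G \<sigma> a = (\<Prod>j\<in>players G. \<sigma> j (a j))"

definition joint_prob ::
    "('a, 't) game \<Rightarrow> nat \<Rightarrow> (nat \<Rightarrow> 'a \<Rightarrow> real) \<Rightarrow> (nat \<Rightarrow> 't \<Rightarrow> real) \<Rightarrow> (nat \<Rightarrow> 'a) \<Rightarrow> 't \<Rightarrow> real" where
  "joint_prob G i \<sigma> \<pi> a \<theta> = (\<Prod>j\<in>players G. \<sigma> j (a j)) * \<pi> i \<theta>"

definition personal_regret ::
    "('a, 't) game \<Rightarrow> nat \<Rightarrow> (nat \<Rightarrow> 'a \<Rightarrow> real) \<Rightarrow> (nat \<Rightarrow> 'a) \<Rightarrow> 't \<Rightarrow> real" where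
  "personal_regret G i \<sigma> a \<theta> =
     Max ((\<lambda>c. \<Sum>b\<in>action_profiles G. utility G i (b(i := c)) \<theta> * profile_prob G \<sigma> b) ` actions G i)
     - utility G i a \<theta>"

definition expected_utility ::
    "('a, 't) game \<Rightarrow> nat \<Rightarrow> (nat \<Rightarrow> 'a \<Rightarrow> real) \<Rightarrow> (nat \<Rightarrow> 't \<Rightarrow> real) \<Rightarrow> real" where
  "expected_utility G i \<sigma> \<pi> =
     (\<Sum>a\<in>action_profiles G. \<Sum>\<theta>\<in>params G. utility G i a \<theta> * joint_prob G i \<sigma> \<pi> a \<theta>)"

definition expected_utility_action ::
    "('a, 't) game \<Rightarrow> nat \<Rightarrow> (nat \<Rightarrow> 'a \<Rightarrow> real) \<Rightarrow> (nat \<Rightarrow> 't \<Rightarrow> real) \<Rightarrow> 'a \<Rightarrow> real" where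
  "expected_utility_action G i \<sigma> \<pi> c =
     (\<Sum>b\<in>action_profiles G. \<Sum>\<theta>\<in>params G. utility G i (b(i := c)) \<theta> * joint_prob G i \<sigma> \<pi> b \<theta>)"

definition expected_regret ::
    "('a, 't) game \<Rightarrow> nat \<Rightarrow> (nat \<Rightarrow> 'a \<Rightarrow> real) \<Rightarrow> (nat \<Rightarrow> 't \<Rightarrow> real) \<Rightarrow> real" where
  "expected_regret G i \<sigma> \<pi> =
     (\<Sum>a\<in>action_profiles G. \<Sum>\<theta>\<in>params G. personal_regret G i \<sigma> a \<theta> * joint_prob G i \<sigma> \<pi> a \<theta>)"

(* The regret conditional on a parameter value does not involve the priors. *)
definition expected_regret_param ::
    "('a, 't) game \<Rightarrow> nat \<Rightarrow> (nat \<Rightarrow> 'a \<Rightarrow> real) \<Rightarrow> 't \<Rightarrow> real" where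
  "expected_regret_param G i \<sigma> \<theta> =
     (\<Sum>a\<in>action_profiles G. personal_regret G i \<sigma> a \<theta> * profile_prob G \<sigma> a)"

definition expected_utility_matrix ::
    "('a, 't) game \<Rightarrow> nat \<Rightarrow> (nat \<Rightarrow> 'a \<Rightarrow> real) \<Rightarrow> 'a \<Rightarrow> 't \<Rightarrow> real" where
  "expected_utility_matrix G i \<sigma> c \<theta> =
     (\<Sum>b\<in>action_profiles G. utility G i (b(i := c)) \<theta> * profile_prob G \<sigma> b)"

definition extended_equilibria ::
    "('a, 't) game \<Rightarrow> ((nat \<Rightarrow> 'a \<Rightarrow> real) \<times> (nat \<Rightarrow> 't \<Rightarrow> real)) set" where
  "extended_equilibria G =
     {(\<sigma>, \<pi>) \<in> complete_profiles G.
        \<forall>i\<in>players G.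
          (\<forall>c\<in>actions G i. expected_utility G i \<sigma> \<pi> \<ge> expected_utility_action G i \<sigma> \<pi> c) \<and>
          (\<forall>\<theta>\<in>params G. expected_regret G i \<sigma> \<pi> \<ge> expected_regret_param G i \<sigma> \<theta>)}"

end

theory Submission
  imports Defs
begin

text \<open>
  Write \<open>V(\<theta>)\<close> for the expected utility of player \<open>i\<close> at the parameter value \<open>\<theta>\<close> and \<open>M(c;\<theta>)\<close> for
  the expected utility matrix. Since \<open>V(\<theta>) = (\<Sum>c. \<sigma>\<^sub>i(c) M(c;\<theta>))\<close> is an average of the column
  \<open>M(\<cdot>;\<theta>)\<close>, the expected regret \<open>ER(\<theta>) = max\<^sub>c M(c;\<theta>) - V(\<theta>)\<close> is nonnegative, and it vanishes only
  if every action played with positive probability maximises that column. Under the pure prior at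
  \<open>\<eta>\<close> the utility condition of the equilibrium says \<open>ER(\<eta>) \<le> 0\<close> and the regret condition says
  \<open>ER(\<theta>) \<le> ER(\<eta>)\<close>. So \<open>ER\<close> vanishes identically, and player \<open>i\<close>'s conditions hold at each parameter
  value separately, hence for every prior.
\<close>

text \<open>The quantity \<open>V(\<theta>)\<close>: it involves no prior, so priors enter later
  only as weights on values fixed by \<open>\<sigma>\<close>.\<close>

definition utility_at ::
    "('a, 't) game \<Rightarrow> nat \<Rightarrow> (nat \<Rightarrow> 'a \<Rightarrow> real) \<Rightarrow> 't \<Rightarrow> real" where
  "utility_at G i \<sigma> \<theta> = (\<Sum>a\<in>action_profiles G. utility G i a \<theta> * profile_prob G \<sigma> a)"

section \<open>Probability simplices and sums over product sets\<close>

lemma simplexD: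
  assumes "p \<in> simplex S"
  shows "s \<in> S \<Longrightarrow> 0 \<le> p s" and "sum p S = 1"
  using assms by (auto simp: simplex_def PiE_iff)

lemma simplex_exists_pos:
  assumes "p \<in> simplex S"
  shows "\<exists>s\<in>S. 0 < p s"
proof (rule ccontr)
  assume "\<not> ?thesis"
  then have "p s = 0" if "s \<in> S" for s
    using simplexD(1)[OF assms that] that by force
  then have "sum p S = 0" by simp
  then show False using simplexD(2)[OF assms] by simp
qed

text \<open>An edge of the simplex, parametrised by \<open>x\<close>; it supplies the continuum of
  priors.\<close>

lemma simplex_two_point:
  assumes "finite S" "s \<in> S" "t \<in> S" "s \<noteq> t" "0 \<le> x" "x \<le> 1"
  shows "(\<lambda>r\<in>S. if r = s then 1 - x else if r = t then x else 0) \<in> simplex S"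
proof -
  have "(\<Sum>r\<in>S. if r = s then 1 - x else if r = t then x else 0)
      = (\<Sum>r\<in>S. (if r = s then 1 - x else 0) + (if r = t then x else 0))"
    using \<open>s \<noteq> t\<close> by (intro sum.cong) auto
  also have "\<dots> = 1"
    using assms by (simp add: sum.distrib)
  finally show ?thesis
    using assms by (auto simp: simplex_def)
qed

text \<open>A profile splits uniquely into coordinate \<open>i\<close> and the rest, so player
  \<open>i\<close>'s own action can be summed out first.\<close>

lemma sum_PiE_remove:
  fixes f :: "('i \<Rightarrow> 'a) \<Rightarrow> 'b::comm_monoid_add"
  assumes "i \<in> I"
  shows "(\<Sum>b\<in>PiE I A. f b) = (\<Sum>g\<in>PiE (I - {i}) A. \<Sum>c\<in>A i. f (g(i := c)))"
proof -
  have "PiE I A = (\<lambda>(c, g). g(i := c)) ` (A i \<times> PiE (I - {i}) A)"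
    using PiE_insert_eq[of i "I - {i}" A] assms by (simp add: insert_absorb)
  moreover have "inj_on (\<lambda>(c, g). g(i := c)) (A i \<times> PiE (I - {i}) A)"
    by (rule inj_combinator) simp
  ultimately have "(\<Sum>b\<in>PiE I A. f b) = (\<Sum>(c, g)\<in>A i \<times> PiE (I - {i}) A. f (g(i := c)))"
    by (simp add: sum.reindex case_prod_unfold)
  also have "\<dots> = (\<Sum>c\<in>A i. \<Sum>g\<in>PiE (I - {i}) A. f (g(i := c)))"
    by (simp add: sum.cartesian_product)
  also have "\<dots> = (\<Sum>g\<in>PiE (I - {i}) A. \<Sum>c\<in>A i. f (g(i := c)))"
    by (rule sum.swap)
  finally show ?thesis .
qed

section \<open>Averages over the parameter\<close>

lemma finite_players: "finite (players G)"
  by (simp add: players_def)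

text \<open>Linear in \<open>\<pi> i\<close> and independent of all other priors; with the two
  analogues below, this confines a change of one prior to the conditions of that player.\<close>

lemma expected_utility_eq:
  "expected_utility G i \<sigma> \<pi> = (\<Sum>\<theta>\<in>params G. \<pi> i \<theta> * utility_at G i \<sigma> \<theta>)"
  unfolding expected_utility_def utility_at_def joint_prob_def profile_prob_def
  by (subst sum.swap) (simp add: sum_distrib_left mult_ac)

lemma expected_utility_action_eq:
  "expected_utility_action G i \<sigma> \<pi> c
     = (\<Sum>\<theta>\<in>params G. \<pi> i \<theta> * expected_utility_matrix G i \<sigma> c \<theta>)"
  unfolding expected_utility_action_def expected_utility_matrix_def joint_prob_def profile_prob_def
  by (subst sum.swap) (simp add: sum_distrib_left mult_ac)

lemma expected_regret_eq:
  "expected_regret G i \<sigma> \<pi> = (\<Sum>\<theta>\<in>params G. \<pi> i \<theta> * expected_regret_param G i \<sigma> \<theta>)"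
  unfolding expected_regret_def expected_regret_param_def joint_prob_def profile_prob_def
  by (subst sum.swap) (simp add: sum_distrib_left mult_ac)

section \<open>Utilities and regrets for fixed strategies\<close>

context
  fixes G :: "('a, 't) game" and \<sigma> :: "nat \<Rightarrow> 'a \<Rightarrow> real"
  assumes game: "game_with_uncertainty G"
    and strategies: "\<sigma> \<in> PiE (players G) (\<lambda>i. simplex (actions G i))"
begin

lemma finite_actions: "i \<in> players G \<Longrightarrow> finite (actions G i)"
  using game by (simp add: game_with_uncertainty_def)

lemma strategy_simplex: "i \<in> players G \<Longrightarrow> \<sigma> i \<in> simplex (actions G i)"
  using strategies by auto

lemma profile_prob_sum: "(\<Sum>a\<in>action_profiles G. profile_prob G \<sigma> a) = 1"
proof -
  have "(\<Sum>a\<in>action_profiles G. profile_prob G \<sigma> a)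
      = (\<Prod>j\<in>players G. \<Sum>c\<in>actions G j. \<sigma> j c)"
    unfolding action_profiles_def profile_prob_def
    by (intro prod_sum_PiE[symmetric] finite_players finite_actions)
  also have "\<dots> = 1"
    using simplexD(2)[OF strategy_simplex] by simp
  finally show ?thesis .
qed

text \<open>Splitting off player \<open>i\<close>'s own action leaves it in the utility with weight
  \<open>\<sigma> i c\<close>, whereas a matrix entry overwrites it.\<close>

lemma utility_at_eq_mixture:
  assumes i: "i \<in> players G"
  shows "utility_at G i \<sigma> \<theta> = (\<Sum>c\<in>actions G i. \<sigma> i c * expected_utility_matrix G i \<sigma> c \<theta>)"
proof -
  let ?P = "\<lambda>g. \<Prod>j\<in>players G - {i}. \<sigma> j (g j)"
  let ?B = "PiE (players G - {i}) (actions G)"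
  have prob: "profile_prob G \<sigma> (g(i := c)) = \<sigma> i c * ?P g" for g c
    unfolding profile_prob_def by (subst prod.remove[OF finite_players i]) simp
  have matrix: "expected_utility_matrix G i \<sigma> c \<theta> = (\<Sum>g\<in>?B. utility G i (g(i := c)) \<theta> * ?P g)"
    for c
  proof -
    \<comment> \<open>The own action \<open>d\<close> is overwritten by \<open>c\<close> and
      survives only in the factor \<open>\<sigma> i d\<close>, which sums to 1.\<close>
    have "expected_utility_matrix G i \<sigma> c \<theta>
        = (\<Sum>g\<in>?B. \<Sum>d\<in>actions G i. utility G i (g(i := c)) \<theta> * (\<sigma> i d * ?P g))"
      unfolding expected_utility_matrix_def action_profiles_def sum_PiE_remove[OF i]
      by (simp add: prob)
    also have "\<dots> = (\<Sum>g\<in>?B. (\<Sum>d\<in>actions G i. \<sigma> i d) * (utility G i (g(i := c)) \<theta> * ?P g))"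
      by (simp add: sum_distrib_right mult_ac)
    finally show ?thesis
      using simplexD(2)[OF strategy_simplex[OF i]] by simp
  qed
  have "utility_at G i \<sigma> \<theta>
      = (\<Sum>g\<in>?B. \<Sum>c\<in>actions G i. utility G i (g(i := c)) \<theta> * (\<sigma> i c * ?P g))"
    unfolding utility_at_def action_profiles_def sum_PiE_remove[OF i] by (simp add: prob)
  also have "\<dots> = (\<Sum>c\<in>actions G i. \<Sum>g\<in>?B. utility G i (g(i := c)) \<theta> * (\<sigma> i c * ?P g))"
    by (rule sum.swap)
  finally show ?thesis
    by (simp add: matrix sum_distrib_left mult_ac)
qed

text \<open>The maximum in \<open>personal_regret\<close> does not depend on the realised profile,
  so averaging multiplies it by total probability 1.\<close>

lemma expected_regret_param_eq:
  "expected_regret_param G i \<sigma> \<theta>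
     = Max ((\<lambda>c. expected_utility_matrix G i \<sigma> c \<theta>) ` actions G i) - utility_at G i \<sigma> \<theta>"
proof -
  let ?m = "Max ((\<lambda>c. expected_utility_matrix G i \<sigma> c \<theta>) ` actions G i)"
  have "expected_regret_param G i \<sigma> \<theta>
      = ?m * (\<Sum>a\<in>action_profiles G. profile_prob G \<sigma> a) - utility_at G i \<sigma> \<theta>"
    unfolding expected_regret_param_def personal_regret_def utility_at_def
      expected_utility_matrix_def[symmetric]
    by (simp add: left_diff_distrib sum_subtractf sum_distrib_left)
  then show ?thesis by (simp add: profile_prob_sum)
qed

text \<open>Trades the maximum for entrywise bounds. It serves with \<open>x = 0\<close>, and with
  \<open>x\<close> the regret itself to bound each entry.\<close>

lemma expected_regret_param_le_iff:
  assumes "i \<in> players G"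
  shows "expected_regret_param G i \<sigma> \<theta> \<le> x \<longleftrightarrow>
    (\<forall>c\<in>actions G i. expected_utility_matrix G i \<sigma> c \<theta> \<le> utility_at G i \<sigma> \<theta> + x)"
proof -
  have "actions G i \<noteq> {}"
    using game assms by (simp add: game_with_uncertainty_def)
  then have "Max ((\<lambda>c. expected_utility_matrix G i \<sigma> c \<theta>) ` actions G i) \<le> utility_at G i \<sigma> \<theta> + x
      \<longleftrightarrow> (\<forall>c\<in>actions G i. expected_utility_matrix G i \<sigma> c \<theta> \<le> utility_at G i \<sigma> \<theta> + x)"
    using finite_actions[OF assms] by simp
  then show ?thesis by (simp add: expected_regret_param_eq algebra_simps)
qed

text \<open>Complementary slackness: the weighted gaps are nonnegative and sum to zero, so a
  positive weight forces a zero gap.\<close>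

lemma utility_at_eq_support:
  assumes i: "i \<in> players G" and a: "a \<in> actions G i" "0 < \<sigma> i a"
    and max: "\<And>c. c \<in> actions G i \<Longrightarrow> expected_utility_matrix G i \<sigma> c \<theta> \<le> utility_at G i \<sigma> \<theta>"
  shows "expected_utility_matrix G i \<sigma> a \<theta> = utility_at G i \<sigma> \<theta>"
proof -
  let ?v = "utility_at G i \<sigma> \<theta>" and ?M = "\<lambda>c. expected_utility_matrix G i \<sigma> c \<theta>"
  note s = simplexD[OF strategy_simplex[OF i]]
  have "(\<Sum>c\<in>actions G i. \<sigma> i c * (?v - ?M c))
      = (\<Sum>c\<in>actions G i. \<sigma> i c) * ?v - (\<Sum>c\<in>actions G i. \<sigma> i c * ?M c)"
    by (simp add: right_diff_distrib sum_subtractf sum_distrib_right)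
  also have "\<dots> = 0"
    using s(2) utility_at_eq_mixture[OF i] by simp
  finally have "(\<Sum>c\<in>actions G i. \<sigma> i c * (?v - ?M c)) = 0" .
  moreover have "\<forall>c\<in>actions G i. 0 \<le> \<sigma> i c * (?v - ?M c)"
    using s(1) max by simp
  ultimately have "\<sigma> i a * (?v - ?M a) = 0"
    using a(1) by (subst (asm) sum_nonneg_eq_0_iff[OF finite_actions[OF i]]) auto
  then show ?thesis using a(2) by simp
qed

end

theorem theorem5p1:
  fixes G :: "('a, 't) game"
    and \<sigma> :: "nat \<Rightarrow> 'a \<Rightarrow> real"
    and \<pi> :: "nat \<Rightarrow> 't \<Rightarrow> real"
    and i :: nat and \<eta> :: 't
  assumes "game_with_uncertainty G"
    and "(\<sigma>, \<pi>) \<in> extended_equilibria G"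
    and "i \<in> players G"
    and "\<eta> \<in> params G"
    and "\<forall>\<theta>\<in>params G. \<pi> i \<theta> = (if \<theta> = \<eta> then 1 else 0)"
  shows "(\<exists>a\<in>actions G i. \<forall>c\<in>actions G i. \<forall>\<theta>\<in>params G.
            expected_utility_matrix G i \<sigma> a \<theta> \<ge> expected_utility_matrix G i \<sigma> c \<theta>)
       \<and> (\<forall>\<pi>'\<in>simplex (params G). (\<sigma>, \<pi>(i := \<pi>')) \<in> extended_equilibria G)
       \<and> (card (params G) \<ge> 2 \<longrightarrow>
            (\<exists>E. E \<subseteq> extended_equilibria G \<and> E \<approx> (UNIV :: real set)))"
proof (intro conjI impI)
  have \<sigma>: "\<sigma> \<in> PiE (players G) (\<lambda>i. simplex (actions G i))"
    and \<pi>: "\<pi> \<in> players G \<rightarrow>\<^sub>E simplex (params G)"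
    and eq: "\<forall>j\<in>players G.
      (\<forall>c\<in>actions G j. expected_utility_action G j \<sigma> \<pi> c \<le> expected_utility G j \<sigma> \<pi>) \<and>
      (\<forall>\<theta>\<in>params G. expected_regret_param G j \<sigma> \<theta> \<le> expected_regret G j \<sigma> \<pi>)"
    using assms(2) by (auto simp: extended_equilibria_def complete_profiles_def)
  note ctx = assms(1) \<sigma>
  note i = assms(3)
  have fin: "finite (params G)"
    using assms(1) by (simp add: game_with_uncertainty_def)
  \<comment> \<open>Averaging against the pure prior is evaluation at \<open>\<eta>\<close>.\<close>
  have delta: "(\<Sum>\<theta>\<in>params G. \<pi> i \<theta> * f \<theta>) = f \<eta>" for f
  proof -
    have "(\<Sum>\<theta>\<in>params G. \<pi> i \<theta> * f \<theta>) = (\<Sum>\<theta>\<in>params G. if \<theta> = \<eta> then f \<theta> else 0)"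
      using assms(5) by (intro sum.cong) auto
    then show ?thesis using fin assms(4) by simp
  qed
  have "expected_utility_matrix G i \<sigma> c \<eta> \<le> utility_at G i \<sigma> \<eta>" if "c \<in> actions G i" for c
  proof -
    have "expected_utility_action G i \<sigma> \<pi> c \<le> expected_utility G i \<sigma> \<pi>"
      using eq i that by blast
    then show ?thesis
      by (simp add: expected_utility_eq expected_utility_action_eq delta)
  qed
  then have *: "expected_regret_param G i \<sigma> \<eta> \<le> 0"
    by (simp add: expected_regret_param_le_iff[OF ctx i])
  have regret: "expected_regret_param G i \<sigma> \<theta> \<le> 0" if "\<theta> \<in> params G" for \<theta>
  proof -
    have "expected_regret_param G i \<sigma> \<theta> \<le> expected_regret G i \<sigma> \<pi>"
      using eq i that by blast
    also have "\<dots> = expected_regret_param G i \<sigma> \<eta>"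
      by (simp add: expected_regret_eq delta)
    finally show ?thesis using * by simp
  qed
  then have le: "expected_utility_matrix G i \<sigma> c \<theta> \<le> utility_at G i \<sigma> \<theta>"
    if "\<theta> \<in> params G" "c \<in> actions G i" for \<theta> c
    using that expected_regret_param_le_iff[OF ctx i, of \<theta> 0] by simp
  \<comment> \<open>The support of \<open>\<sigma> i\<close> does not depend on the parameter, so
    one action serves every \<open>\<theta>\<close>.\<close>
  obtain a where a: "a \<in> actions G i" "0 < \<sigma> i a"
    using simplex_exists_pos[OF strategy_simplex[OF ctx i]] by blast
  have best: "expected_utility_matrix G i \<sigma> a \<theta> = utility_at G i \<sigma> \<theta>" if "\<theta> \<in> params G" for \<theta>
    using utility_at_eq_support[OF ctx i a] le that by blast
  show "\<exists>a\<in>actions G i. \<forall>c\<in>actions G i. \<forall>\<theta>\<in>params G.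
      expected_utility_matrix G i \<sigma> a \<theta> \<ge> expected_utility_matrix G i \<sigma> c \<theta>"
    by (rule bexI[OF _ a(1)]) (simp add: best le)
  \<comment> \<open>Equality is needed, not just the upper bound: the average regret under an
    arbitrary new prior must reach each single regret.\<close>
  have regret_0: "expected_regret_param G i \<sigma> \<theta> = 0" if "\<theta> \<in> params G" for \<theta>
  proof (rule antisym)
    have "expected_utility_matrix G i \<sigma> a \<theta>
        \<le> utility_at G i \<sigma> \<theta> + expected_regret_param G i \<sigma> \<theta>"
      using expected_regret_param_le_iff[OF ctx i] a(1) by blast
    then show "0 \<le> expected_regret_param G i \<sigma> \<theta>"
      using best[OF that] by simp
  qed (rule regret[OF that])
  show degenerate: "\<forall>\<pi>'\<in>simplex (params G). (\<sigma>, \<pi>(i := \<pi>')) \<in> extended_equilibria G"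
  proof
    fix \<pi>' assume \<pi>': "\<pi>' \<in> simplex (params G)"
    let ?\<pi> = "\<pi>(i := \<pi>')"
    have "?\<pi> \<in> players G \<rightarrow>\<^sub>E simplex (params G)"
      using \<pi> \<pi>' i by (auto simp: PiE_iff extensional_def)
    \<comment> \<open>For player \<open>i\<close> the inequality holds at each
      \<open>\<theta>\<close> and survives nonnegative weights; for other players neither side
      changes.\<close>
    moreover have "expected_utility_action G j \<sigma> ?\<pi> c \<le> expected_utility G j \<sigma> ?\<pi>"
      if "j \<in> players G" "c \<in> actions G j" for j c
    proof (cases "j = i")
      case True
      then show ?thesis
        using that le simplexD(1)[OF \<pi>']
        by (auto simp: expected_utility_eq expected_utility_action_eq
            intro!: sum_mono mult_left_mono)
    next
      case False
      then show ?thesis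
        using bspec[OF eq that(1)] that(2)
        by (simp add: expected_utility_eq expected_utility_action_eq)
    qed
    moreover have "expected_regret_param G j \<sigma> \<theta> \<le> expected_regret G j \<sigma> ?\<pi>"
      if "j \<in> players G" "\<theta> \<in> params G" for j \<theta>
      using bspec[OF eq that(1)] that(2)
      by (cases "j = i") (simp_all add: expected_regret_eq regret_0)
    ultimately show "(\<sigma>, ?\<pi>) \<in> extended_equilibria G"
      using \<sigma> by (simp add: extended_equilibria_def complete_profiles_def)
  qed
  assume "card (params G) \<ge> 2"
  then have "params G - {\<eta>} \<noteq> {}"
    by (auto simp: subset_singleton_iff)
  then obtain \<theta> where \<theta>: "\<theta> \<in> params G" "\<eta> \<noteq> \<theta>" by blast
  \<comment> \<open>The map \<open>1 / (1 + exp x)\<close> sends the reals injectively into the open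
    unit interval, so the family is indexed by all of \<open>real\<close> directly.\<close>
  define p :: "real \<Rightarrow> 't \<Rightarrow> real" where
    "p x = (\<lambda>r\<in>params G. if r = \<eta> then 1 - 1 / (1 + exp x)
       else if r = \<theta> then 1 / (1 + exp x) else 0)" for x
  let ?F = "\<lambda>x. (\<sigma>, \<pi>(i := p x))"
  have "p x \<in> simplex (params G)" for x
    unfolding p_def using fin assms(4) \<theta>
    by (intro simplex_two_point) (auto simp: divide_le_eq_1 add_pos_pos)
  then have "range ?F \<subseteq> extended_equilibria G"
    using degenerate by blast
  moreover have "inj ?F"
  proof (rule injI)
    fix x y assume "?F x = ?F y"
    \<comment> \<open>The weight at \<open>\<theta>\<close> alone recovers \<open>x\<close>.\<close>
    then have "p x \<theta> = p y \<theta>" by (metis fun_upd_same prod.inject)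
    then have "1 / (1 + exp x) = 1 / (1 + exp y)"
      using \<theta> by (simp add: p_def)
    then show "x = y" by simp
  qed
  ultimately show "\<exists>E. E \<subseteq> extended_equilibria G \<and> E \<approx> (UNIV :: real set)"
    using inj_on_image_eqpoll_self by blast
qed

end
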